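(* Let $\Sigma$ be an alphabet with $|\Sigma|\geq2$, let $G$ be a finite simple graph, and let $H$ be the underlying graph of the line digraph $\delta G$. If there exists an index code for $\overline{H}$ over $\Sigma$ of length $k$, then $\chi(G)\leq 2^{|\Sigma|^k}$.
   Context: For a graph $G$ on a finite vertex set $V$ (identified with $[n]$) and a finite alphabet $\Sigma$, an index code for $G$ over $\Sigma$ of length $k$ is a function $E:\Sigma^n\to\Sigma^k$ such that for every vertex $i$ there is a function $g_i:\Sigma^{k+|N_G(i)|}\to\Sigma$ with $g_i(E(x),x|_{N_G(i)})=x_i$ for all $x\in\Sigma^n$, where $N_G(i)$ is the set of neighbors of $i$ and $x|_{N_G(i)}$ the restriction of $x$ to these coordinates. $\overline{H}$ is the complement graph and $\chi$ the chromatic number. The line digraph $\delta G$ has as vertices all ordered pairs $(x,y)$ with $\{x,y\}$ an edge of $G$, with a directed edge from $(x,y)$ to $(z,w)$ whenever $y=z$; $H$ is obtained by ignoring directions. *)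

theory Defs
  imports "HOL-Library.FuncSet" "Graph_Theory.Graph_Theory"
begin

text \<open>
  A finite simple graph is a \<^locale>\<open>pair_graph\<close>: a finite, loop-free, symmetric digraph
  without parallel arcs. An undirected edge between \<open>u\<close> and \<open>v\<close> is represented by the two
  arcs \<open>(u, v)\<close> and \<open>(v, u)\<close>, so \<^const>\<open>parcs\<close> is the adjacency relation, and also the set
  of all ordered pairs whose underlying unordered pair is an edge.
\<close>

definition complement_graph :: "'a pair_pre_digraph \<Rightarrow> 'a pair_pre_digraph" where
  "complement_graph G = \<lparr> pverts = pverts G,
     parcs = {(u, v). u \<in> pverts G \<and> v \<in> pverts G \<and> u \<noteq> v \<and> (u, v) \<notin> parcs G} \<rparr>"

definition neighbors :: "'a pair_pre_digraph \<Rightarrow> 'a \<Rightarrow> 'a set" where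
  "neighbors G u = {v. (u, v) \<in> parcs G}"

definition proper_coloring :: "'a pair_pre_digraph \<Rightarrow> nat \<Rightarrow> ('a \<Rightarrow> nat) \<Rightarrow> bool" where
  "proper_coloring G m c \<longleftrightarrow>
     c \<in> pverts G \<rightarrow> {..<m} \<and> (\<forall>(u, v) \<in> parcs G. c u \<noteq> c v)"

definition chromatic_number :: "'a pair_pre_digraph \<Rightarrow> nat" where
  "chromatic_number G = (LEAST m. \<exists>c. proper_coloring G m c)"

definition line_digraph :: "'a pair_pre_digraph \<Rightarrow> ('a \<times> 'a) pair_pre_digraph" where
  "line_digraph G = \<lparr> pverts = parcs G,
     parcs = {((x, y), (z, w)). (x, y) \<in> parcs G \<and> (z, w) \<in> parcs G \<and> y = z} \<rparr>"

definition underlying_line_graph :: "'a pair_pre_digraph \<Rightarrow> ('a \<times> 'a) pair_pre_digraph" where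
  "underlying_line_graph G = mk_symmetric (line_digraph G)"

text \<open>
  Tuples are extensional functions on their index set: \<open>\<Sigma>\<^sup>n\<close> is \<open>pverts G \<rightarrow>\<^sub>E \<Sigma>\<close>, where
  the vertex set itself serves as the index set \<open>[n]\<close>, and \<open>\<Sigma>\<^sup>k\<close> is \<open>{..<k} \<rightarrow>\<^sub>E \<Sigma>\<close>.
  The decoder of vertex \<open>i\<close> takes its argument in \<open>\<Sigma>\<^bsup>k + |N(i)|\<^esup>\<close> as a pair in curried form:
  the code word and the restriction of \<open>x\<close> to the neighbors of \<open>i\<close>.
\<close>

definition index_code ::
  "'a pair_pre_digraph \<Rightarrow> 's set \<Rightarrow> nat \<Rightarrow> (('a \<Rightarrow> 's) \<Rightarrow> (nat \<Rightarrow> 's)) \<Rightarrow> bool" where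
  "index_code G \<Sigma> k E \<longleftrightarrow>
     E \<in> (pverts G \<rightarrow>\<^sub>E \<Sigma>) \<rightarrow> ({..<k} \<rightarrow>\<^sub>E \<Sigma>) \<and>
     (\<forall>i \<in> pverts G. \<exists>g \<in> ({..<k} \<rightarrow>\<^sub>E \<Sigma>) \<rightarrow> (neighbors G i \<rightarrow>\<^sub>E \<Sigma>) \<rightarrow> \<Sigma>.
        \<forall>x \<in> pverts G \<rightarrow>\<^sub>E \<Sigma>. g (E x) (restrict x (neighbors G i)) = x i)"

lemma pair_graph_complement_graph:
  assumes "pair_graph G"
  shows "pair_graph (complement_graph G)"
proof -
  interpret pair_graph G by fact
  have sym: "(u, v) \<in> parcs G \<longleftrightarrow> (v, u) \<in> parcs G" for u v
    using pair_sym_arcs by (auto simp: symmetric_def sym_def)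
  have fin: "finite (parcs (complement_graph G))"
    by (rule finite_subset[of _ "pverts G \<times> pverts G"]) (auto simp: complement_graph_def)
  show ?thesis
    using fin by unfold_locales
      (auto simp: complement_graph_def symmetric_def sym_def sym)
qed

lemma pair_graph_underlying_line_graph:
  assumes "pair_graph G"
  shows "pair_graph (underlying_line_graph G)"
proof -
  interpret pair_graph G by fact
  have fin: "finite (parcs (line_digraph G))"
    by (rule finite_subset[of _ "parcs G \<times> parcs G"]) (auto simp: line_digraph_def)
  interpret L: pair_digraph "line_digraph G"
    using fin by unfold_locales (auto simp: line_digraph_def dest: pair_no_loops)
  interpret S: pair_digraph "mk_symmetric (line_digraph G)"
    by (rule L.digraph_mk_symmetric)
  show ?thesis
    unfolding underlying_line_graph_def
    by unfold_locales (rule symmetric_mk_symmetric)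
qed

lemma proper_coloring_exists:
  assumes "pair_graph G"
  shows "\<exists>m c. proper_coloring G m c"
proof -
  interpret pair_graph G by fact
  obtain f :: "'a \<Rightarrow> nat" and m where f: "f ` pverts G = {i. i < m}" "inj_on f (pverts G)"
    using finite_imp_inj_to_nat_seg[OF pair_finite_verts] by metis
  have "proper_coloring G m f"
    unfolding proper_coloring_def
  proof (intro conjI ballI)
    show "f \<in> pverts G \<rightarrow> {..<m}" using f(1) by auto
  next
    fix e assume e: "e \<in> parcs G"
    have "fst e \<in> pverts G" "snd e \<in> pverts G" "fst e \<noteq> snd e"
      using e by (rule arc_fst_in_verts arc_snd_in_verts pair_no_loops)+
    then have "f (fst e) \<noteq> f (snd e)"
      using f(2) by (simp add: inj_on_eq_iff)
    then show "case e of (u, v) \<Rightarrow> f u \<noteq> f v"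
      by (simp add: case_prod_beta)
  qed
  then show ?thesis by blast
qed

end

theory Submission
  imports Defs
begin

text \<open>
  Fix distinct letters \<open>p\<close>, \<open>q\<close> of \<open>\<Sigma>\<close> and colour a vertex \<open>v\<close> of \<open>G\<close> by the set of the code
  words of those tuples that have the letter \<open>p\<close> in a single coordinate, which is an arc
  leaving \<open>v\<close>, and \<open>q\<close> elsewhere. Let \<open>a = (u, v)\<close> be an arc. All arcs leaving \<open>v\<close> are
  adjacent to \<open>a\<close> in \<open>H\<close>, so the decoder of \<open>a\<close> does not see them: when its side information is
  constantly \<open>q\<close>, it answers \<open>q\<close> on every code word in the colour of \<open>v\<close>. But it
  answers \<open>p\<close> on the code word of the tuple marking \<open>a\<close>, which is in the colour of \<open>u\<close>.
\<close>

text \<open>Numbering the colours by a bijection allows colours of any type, here sets of code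
  words.\<close>

lemma chromatic_number_le_card:
  fixes f :: "'a \<Rightarrow> 'c"
  assumes "finite C" and "f \<in> pverts G \<rightarrow> C"
    and "\<And>u v. (u, v) \<in> parcs G \<Longrightarrow> f u \<noteq> f v"
    and "parcs G \<subseteq> pverts G \<times> pverts G"
  shows "chromatic_number G \<le> card C"
proof -
  obtain h where h: "bij_betw h C {0..<card C}"
    using ex_bij_betw_finite_nat[OF assms(1)] by blast
  have "h (f u) \<noteq> h (f v)" if "(u, v) \<in> parcs G" for u v
  proof -
    have "f u \<in> C" "f v \<in> C" using assms(2,4) that by auto
    then show ?thesis
      using assms(3)[OF that] h by (auto simp: bij_betw_def inj_on_eq_iff)
  qed
  moreover have "h \<circ> f \<in> pverts G \<rightarrow> {..<card C}"
    using assms(2) bij_betwE[OF h] by fastforce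
  ultimately have "proper_coloring G (card C) (h \<circ> f)"
    unfolding proper_coloring_def by auto
  then show ?thesis
    unfolding chromatic_number_def by (blast intro: Least_le)
qed

lemma pverts_complement_underlying_line_graph:
  "pverts (complement_graph (underlying_line_graph G)) = parcs G"
  by (simp add: complement_graph_def underlying_line_graph_def line_digraph_def mk_symmetric_def)

lemma neighbors_complement_graph_subset:
  "neighbors (complement_graph G) u \<subseteq> pverts G - {u}"
  by (auto simp: neighbors_def complement_graph_def)

lemma out_arc_notin_neighbors_complement:
  assumes "(u, v) \<in> parcs G" and "(v, w) \<in> parcs G"
  shows "(v, w) \<notin> neighbors (complement_graph (underlying_line_graph G)) (u, v)"
  using assms
  by (auto simp: neighbors_def complement_graph_def underlying_line_graph_def
      mk_symmetric_def line_digraph_def)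

theorem theorem3p17:
  fixes G :: "'a pair_pre_digraph" and \<Sigma> :: "'s set" and k :: nat
  assumes "finite \<Sigma>" and "card \<Sigma> \<ge> 2"
    and "pair_graph G"
    and "\<exists>E. index_code (complement_graph (underlying_line_graph G)) \<Sigma> k E"
  shows "chromatic_number G \<le> 2 ^ (card \<Sigma> ^ k)"
proof -
  interpret pair_graph G by fact
  let ?H' = "complement_graph (underlying_line_graph G)"
  let ?W = "{..<k} \<rightarrow>\<^sub>E \<Sigma>"
  obtain p q where pq: "p \<in> \<Sigma>" "q \<in> \<Sigma>" "p \<noteq> q"
    using obtain_subset_with_card_n[OF assms(2)] by (metis card_2_iff insert_subset)
  obtain E where E: "index_code ?H' \<Sigma> k E"
    using assms(4) by blast
  define mark where "mark b = (\<lambda>a \<in> parcs G. if a = b then p else q)" for b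
  define f where "f v = {E (mark b) | b. b \<in> parcs G \<and> fst b = v}" for v
  have mark: "mark b \<in> parcs G \<rightarrow>\<^sub>E \<Sigma>" for b
    using pq by (auto simp: mark_def)
  \<comment> \<open>Neighbours lie in \<open>parcs G\<close>, so \<open>mark b\<close> is
    \<open>q\<close> there and never \<open>undefined\<close>.\<close>
  have unseen: "restrict (mark b) (neighbors ?H' a) = (\<lambda>_ \<in> neighbors ?H' a. q)"
    if "b \<notin> neighbors ?H' a" for a b
    using that neighbors_complement_graph_subset[of "underlying_line_graph G" a]
    by (auto simp: mark_def restrict_def fun_eq_iff underlying_line_graph_def
        line_digraph_def mk_symmetric_def)
  have "f u \<noteq> f v" if uv: "(u, v) \<in> parcs G" for u v
  proof
    assume eq: "f u = f v"
    obtain g where g: "\<And>x. x \<in> parcs G \<rightarrow>\<^sub>E \<Sigma> \<Longrightarrow>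
        g (E x) (restrict x (neighbors ?H' (u, v))) = x (u, v)"
      using E uv unfolding index_code_def pverts_complement_underlying_line_graph by meson
    have "E (mark (u, v)) \<in> f u"
      using uv by (force simp: f_def)
    then obtain w where w: "(v, w) \<in> parcs G" "E (mark (u, v)) = E (mark (v, w))"
      unfolding eq by (auto simp: f_def)
    \<comment> \<open>No vertex neighbours itself, so neither mark is visible to \<open>g\<close>:
      both tuples give it the same code word and the same constant side information.\<close>
    have "(u, v) \<notin> neighbors ?H' (u, v)"
      using neighbors_complement_graph_subset by fast
    then have "mark (u, v) (u, v) = mark (v, w) (u, v)"
      using g[OF mark[of "(u, v)"]] g[OF mark[of "(v, w)"]] w(2)
        out_arc_notin_neighbors_complement[OF uv w(1)] by (simp add: unseen)
    \<comment> \<open>Hence \<open>(v, w)\<close> differs from \<open>(u, v)\<close>, and the two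
      marks read \<open>p\<close> and \<open>q\<close> at \<open>(u, v)\<close>.\<close>
    moreover have "u \<noteq> v"
      using pair_no_loops[OF uv] by simp
    ultimately show False
      using uv pq(3) by (simp add: mark_def)
  qed
  \<comment> \<open>Colours are subsets of a set of size \<open>card \<Sigma> ^ k\<close>, whence
    the outer power of two.\<close>
  moreover have "f \<in> pverts G \<rightarrow> Pow ?W"
    using E mark unfolding index_code_def pverts_complement_underlying_line_graph f_def
    by blast
  moreover have "finite ?W"
    using assms(1) by (simp add: finite_PiE)
  moreover have "parcs G \<subseteq> pverts G \<times> pverts G"
    using arc_fst_in_verts arc_snd_in_verts by force
  ultimately have "chromatic_number G \<le> card (Pow ?W)"
    by (intro chromatic_number_le_card[of _ f]) auto
  also have "\<dots> = 2 ^ (card \<Sigma> ^ k)"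
    using \<open>finite ?W\<close> by (simp add: card_Pow card_PiE)
  finally show ?thesis .
qed

end
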